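(* For every integer $d\geq 4$ there exists a quantum state $\rho$ on $\mathbb{C}^d\otimes\mathbb{C}^d$ that is invariant under partial transposition on the second tensor factor, i.e. $(\mathrm{id}\otimes T)(\rho)=\rho$, and satisfies \[ \mathrm{SN}(\rho)\geq\begin{cases}\lceil (d-2)/8\rceil & \text{if } d \text{ is even},\\ \lceil (d-3)/8\rceil & \text{if } d \text{ is odd}.\end{cases} \]
   Context: $T$ denotes transposition in the computational basis. The Schmidt rank of $\ket{\psi}\in\mathbb{C}^d\otimes\mathbb{C}^d$ is the rank of $\mathrm{tr}_A\ket{\psi}\bra{\psi}$; $\mathrm{SN}(\rho)$ is the minimum over decompositions $\rho=\sum_ip_i\ket{\psi_i}\bra{\psi_i}$ into convex combinations of pure states of the maximal Schmidt rank of the $\ket{\psi_i}$. *)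

theory Defs
  imports Complex_Main "Jordan_Normal_Form.DL_Rank"
begin

text \<open>Vectors in C^d (x) C^d are coefficient functions psi i j (i: first factor, j: second),
  required to vanish outside {0..<d} x {0..<d}. Operators are kernels
  rho i j k l = <i j| rho |k l>.\<close>

type_synonym bivec = "nat \<Rightarrow> nat \<Rightarrow> complex"
type_synonym biop = "nat \<Rightarrow> nat \<Rightarrow> nat \<Rightarrow> nat \<Rightarrow> complex"

definition is_bivec :: "nat \<Rightarrow> bivec \<Rightarrow> bool" where
  "is_bivec d \<psi> \<longleftrightarrow> (\<forall>i j. (d \<le> i \<or> d \<le> j) \<longrightarrow> \<psi> i j = 0)"

definition unit_bivec :: "nat \<Rightarrow> bivec \<Rightarrow> bool" where
  "unit_bivec d \<psi> \<longleftrightarrow> is_bivec d \<psi> \<and> (\<Sum>i<d. \<Sum>j<d. (cmod (\<psi> i j))\<^sup>2) = 1"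

definition is_biop :: "nat \<Rightarrow> biop \<Rightarrow> bool" where
  "is_biop d \<rho> \<longleftrightarrow> (\<forall>i j k l. (d \<le> i \<or> d \<le> j \<or> d \<le> k \<or> d \<le> l) \<longrightarrow> \<rho> i j k l = 0)"

definition expect :: "nat \<Rightarrow> biop \<Rightarrow> bivec \<Rightarrow> complex" where
  "expect d \<rho> x = (\<Sum>i<d. \<Sum>j<d. \<Sum>k<d. \<Sum>l<d. cnj (x i j) * \<rho> i j k l * x k l)"

definition trace_op :: "nat \<Rightarrow> biop \<Rightarrow> complex" where
  "trace_op d \<rho> = (\<Sum>i<d. \<Sum>j<d. \<rho> i j i j)"

definition quantum_state :: "nat \<Rightarrow> biop \<Rightarrow> bool" where
  "quantum_state d \<rho> \<longleftrightarrow> is_biop d \<rho>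
     \<and> (\<forall>x. is_bivec d x \<longrightarrow> Im (expect d \<rho> x) = 0 \<and> Re (expect d \<rho> x) \<ge> 0)
     \<and> trace_op d \<rho> = 1"

definition partial_transpose_B :: "biop \<Rightarrow> biop" where
  "partial_transpose_B \<rho> = (\<lambda>i j k l. \<rho> i l k j)"

definition proj :: "bivec \<Rightarrow> biop" where
  "proj \<psi> = (\<lambda>i j k l. \<psi> i j * cnj (\<psi> k l))"

definition reduced_B :: "nat \<Rightarrow> bivec \<Rightarrow> complex mat" where
  "reduced_B d \<psi> = mat d d (\<lambda>(j, l). \<Sum>i<d. \<psi> i j * cnj (\<psi> i l))"

definition schmidt_rank :: "nat \<Rightarrow> bivec \<Rightarrow> nat" where
  "schmidt_rank d \<psi> = vec_space.rank d (reduced_B d \<psi>)"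

definition schmidt_number :: "nat \<Rightarrow> biop \<Rightarrow> nat" where
  "schmidt_number d \<rho> = (LEAST k. \<exists>(n::nat) (p::nat \<Rightarrow> real) (\<psi>::nat \<Rightarrow> bivec).
      (\<forall>i<n. p i \<ge> 0 \<and> unit_bivec d (\<psi> i)) \<and> (\<Sum>i<n. p i) = 1
      \<and> \<rho> = (\<lambda>a b c e. \<Sum>i<n. complex_of_real (p i) * proj (\<psi> i) a b c e)
      \<and> (\<forall>i<n. schmidt_rank d (\<psi> i) \<le> k))"

end

theory Submission
  imports Defs
begin

text \<open>Let \<open>m = d div 4\<close>. On \<open>(C^2 (x) C^m) (x) (C^2 (x) C^m)\<close> there is a Bell-diagonal mixture \<open>\<sigma>\<close> with
  positive partial transpose whose component at the Bell state \<open>|00> + |11>\<close> is maximally entangled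
  on \<open>C^m (x) C^m\<close>. Flagging \<open>\<sigma>\<close> and its partial transpose on a further qubit of the second party
  by the orthogonal states \<open>(1, \<i>)\<close> and \<open>(1, -\<i>)\<close>, which transposition exchanges, yields an
  invariant state. Contracting the flag with \<open>(1, \<i>)\<close> and the two qubits with \<open>|00> + |11>\<close> maps the
  state to a multiple of a pure maximally entangled state, hence maps every vector of any
  decomposition to a multiple of it, and to a nonzero one for at least one vector. Contraction
  with a vector of Schmidt rank 2 at most doubles the Schmidt rank, so \<open>m\<close> is at most twice the
  Schmidt number.\<close>

section \<open>Rank factorization and underdetermined linear systems\<close>

text \<open>A maximal independent set \<open>S\<close> of columns has \<open>rank A\<close> elements
  and spans every column; \<open>\<alpha> j\<close> holds the coordinates of column
  \<open>j\<close>.\<close>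

lemma (in vec_space) rank_expansion:
  assumes A: "A \<in> carrier_mat n nc"
  obtains S \<alpha> where "finite S" "card S = rank A"
    "\<And>i j. i < n \<Longrightarrow> j < nc \<Longrightarrow> A $$ (i, j) = (\<Sum>b\<in>S. \<alpha> j b * b $ i)"
proof -
  let ?P = "\<lambda>T. T \<subseteq> set (cols A) \<and> lin_indpt T"
  have "lin_indpt {}"
    by (simp add: lin_dep_def)
  then obtain S where S: "finite S" "maximal S ?P"
    using maximal_exists_superset[of "set (cols A)" ?P "{}"] by auto
  have cols: "set (cols A) \<subseteq> carrier_vec n"
    using A cols_dim by blast
  have Ssub: "S \<subseteq> set (cols A)" and Sind: "lin_indpt S"
    using S(2) unfolding maximal_def by auto
  have SV: "S \<subseteq> carrier_vec n"
    using Ssub cols by blast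
  have in_span: "col A j \<in> span S" if "j < nc" for j
  proof (cases "col A j \<in> S")
    case True
    then show ?thesis using in_own_span[OF SV] by blast
  next
    case False
    have cj: "col A j \<in> set (cols A)"
      using that A by (auto simp: cols_def)
    show ?thesis
    proof (rule ccontr)
      assume "col A j \<notin> span S"
      then have "lin_indpt (S \<union> {col A j})"
        using lin_dep_iff_in_span[OF SV Sind _ False] cj cols by blast
      then show False
        using S(2) cj Ssub False unfolding maximal_def by blast
    qed
  qed
  have "\<exists>a. col A j = lincomb a S" if "j < nc" for j
    using in_span[OF that] finite_span[OF S(1) SV] by auto
  then obtain \<alpha> where \<alpha>: "\<And>j. j < nc \<Longrightarrow> col A j = lincomb (\<alpha> j) S"
    by metis
  show thesis
  proof (rule that[OF S(1)])
    show "card S = rank A"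
      using rank_card_indpt[OF A S(2)] by simp
  next
    fix i j assume ij: "i < n" "j < nc"
    have "A $$ (i, j) = col A j $ i"
      using ij A by simp
    also have "\<dots> = (\<Sum>b\<in>S. \<alpha> j b * b $ i)"
      using \<alpha>[OF ij(2)] lincomb_index[OF ij(1) SV] by simp
    finally show "A $$ (i, j) = (\<Sum>b\<in>S. \<alpha> j b * b $ i)" .
  qed
qed

text \<open>Padding the coefficients with zero rows gives an \<open>m\<close> by \<open>m\<close>
  matrix. Row \<open>card S\<close> is zero, so the determinant vanishes and the kernel is
  nontrivial.\<close>

lemma homogeneous_system_solution:
  fixes f :: "'b \<Rightarrow> nat \<Rightarrow> 'a :: field"
  assumes "finite S" "card S < m"
  obtains c where "\<exists>x<m. c x \<noteq> 0" "\<And>b. b \<in> S \<Longrightarrow> (\<Sum>x<m. f b x * c x) = 0"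
proof -
  obtain h where h: "bij_betw h {..<card S} S"
    using ex_bij_betw_nat_finite[OF assms(1)] by (auto simp: atLeast0LessThan)
  define A where "A = mat m m (\<lambda>(i, x). if i < card S then f (h i) x else 0)"
  have A: "A \<in> carrier_mat m m"
    by (simp add: A_def)
  have A_rows: "A = mat\<^sub>r m m (\<lambda>i. if i = card S then 0\<^sub>v m else row A i)"
    using assms(2) by (intro eq_matI) (auto simp: A_def)
  have "row A \<in> {0..<m} \<rightarrow> carrier_vec m"
    using A by auto
  then have "det A = 0"
    by (subst A_rows) (rule det_row_0[OF assms(2)])
  then obtain v where v: "v \<in> carrier_vec m" "v \<noteq> 0\<^sub>v m" "A *\<^sub>v v = 0\<^sub>v m"
    using det_0_iff_vec_prod_zero_field[OF A] by blast
  show thesis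
  proof (rule that[of "\<lambda>x. v $ x"])
    show "\<exists>x<m. v $ x \<noteq> 0"
      using v(1,2) eq_vecI[of v "0\<^sub>v m"] by auto
  next
    fix b assume "b \<in> S"
    then obtain i where i: "i < card S" "b = h i"
      using h unfolding bij_betw_def by auto
    have "(A *\<^sub>v v) $ i = 0"
      using v(3) i assms(2) by simp
    then show "(\<Sum>x<m. f b x * v $ x) = 0"
      using i assms(2) v(1) by (simp add: A_def scalar_prod_def atLeast0LessThan)
  qed
qed

lemma sum_lessThan_mult_4:
  fixes h :: "nat \<Rightarrow> 'a :: comm_monoid_add"
  shows "(\<Sum>l<4 * m. h l) = (\<Sum>y<m. h (4 * y) + h (4 * y + 1) + h (4 * y + 2) + h (4 * y + 3))"
  by (induction m) (simp_all add: eval_nat_numeral add_ac)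

section \<open>Lower bound for the Schmidt rank of one vector\<close>

text \<open>The reduced matrix is a Gram matrix: its quadratic form at \<open>v\<close> is the sum
  of all \<open>|t i|^2\<close>, so a kernel vector makes each \<open>t i\<close> vanish.\<close>

lemma reduced_B_kernel:
  assumes "\<And>j. j < d \<Longrightarrow> (\<Sum>l<d. reduced_B d \<psi> $$ (j, l) * v l) = 0" "i < d"
  shows "(\<Sum>j<d. cnj (v j) * \<psi> i j) = 0"
proof -
  define t where "t i = (\<Sum>j<d. cnj (v j) * \<psi> i j)" for i
  have "complex_of_real (\<Sum>i<d. (cmod (t i))\<^sup>2) = (\<Sum>i<d. t i * cnj (t i))"
    by (simp add: complex_norm_square del: of_real_power)
  also have "\<dots> = (\<Sum>i<d. \<Sum>j<d. \<Sum>l<d. cnj (v j) * (\<psi> i j * cnj (\<psi> i l) * v l))"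
    unfolding t_def cnj_sum sum_product by (simp add: mult_ac)
  also have "\<dots> = (\<Sum>j<d. \<Sum>i<d. \<Sum>l<d. cnj (v j) * (\<psi> i j * cnj (\<psi> i l) * v l))"
    by (rule sum.swap)
  also have "\<dots> = (\<Sum>j<d. \<Sum>l<d. \<Sum>i<d. cnj (v j) * (\<psi> i j * cnj (\<psi> i l) * v l))"
    by (intro sum.cong refl sum.swap)
  also have "\<dots> = (\<Sum>j<d. cnj (v j) * (\<Sum>l<d. reduced_B d \<psi> $$ (j, l) * v l))"
    by (simp add: reduced_B_def sum_distrib_left sum_distrib_right)
  also have "\<dots> = 0"
    using assms(1) by simp
  finally have "(\<Sum>i<d. (cmod (t i))\<^sup>2) = 0"
    using of_real_eq_0_iff by blast
  then have "\<forall>i\<in>{..<d}. (cmod (t i))\<^sup>2 = 0"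
    by (subst (asm) sum_nonneg_eq_0_iff) auto
  then show ?thesis
    using assms(2) by (simp add: t_def)
qed

text \<open>The block of \<open>\<psi>\<close> obtained by contracting the two qubits in the lowest bits (of the first index
  and of half the second index) with \<open>|00> + |11>\<close> and the flag qubit with \<open>(1, \<i>)\<close>.\<close>

definition overlap :: "bivec \<Rightarrow> nat \<Rightarrow> nat \<Rightarrow> complex" where
  "overlap \<psi> x y = \<psi> (2 * x) (4 * y) - \<i> * \<psi> (2 * x) (4 * y + 1)
     + \<psi> (2 * x + 1) (4 * y + 2) - \<i> * \<psi> (2 * x + 1) (4 * y + 3)"

lemma schmidt_rank_ge:
  assumes dm: "4 * m \<le> d" and z: "z \<noteq> 0"
    and ov: "\<And>x y. x < m \<Longrightarrow> y < m \<Longrightarrow> overlap \<psi> x y = (if x = y then z else 0)"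
  shows "m \<le> 2 * schmidt_rank d \<psi>"
proof (rule ccontr)
  assume "\<not> m \<le> 2 * schmidt_rank d \<psi>"
  then have lt: "2 * schmidt_rank d \<psi> < m" by simp
  let ?R = "reduced_B d \<psi>"
  obtain S \<alpha> where S: "finite S" "card S = schmidt_rank d \<psi>"
    and \<alpha>: "\<And>i j. i < d \<Longrightarrow> j < d \<Longrightarrow> ?R $$ (i, j) = (\<Sum>b\<in>S. \<alpha> j b * b $ i)"
    using vec_space.rank_expansion[of ?R d d] unfolding schmidt_rank_def
    by (auto simp: reduced_B_def)
  text \<open>The identity block is a sum of two compressions of \<open>\<psi>\<close>, one for each qubit value \<open>a\<close>; a vector
    killed by both compressions would be in its kernel, and asking for this is a system of at most
    \<open>2 * schmidt_rank d \<psi>\<close> linear equations in \<open>m\<close> unknowns.\<close>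
  define f where "f = (\<lambda>(b, a) y. \<alpha> (4 * y + 2 * a) b + \<i> * \<alpha> (4 * y + 2 * a + 1) b)"
  have "finite (S \<times> {0, 1 :: nat})" "card (S \<times> {0, 1 :: nat}) < m"
    using lt S by (simp_all add: card_cartesian_product)
  then obtain c where c: "\<exists>x<m. c x \<noteq> 0"
    and c0: "\<And>s. s \<in> S \<times> {0, 1} \<Longrightarrow> (\<Sum>y<m. f s y * c y) = 0"
    using homogeneous_system_solution[of "S \<times> {0, 1 :: nat}" m f] by blast
  \<comment> \<open>\<open>v a\<close> is the product of \<open>c\<close>, the qubit basis state
    \<open>a\<close> and the flag \<open>(1, \<i>)\<close>. Its conjugate supplies the factor
    \<open>- \<i>\<close> of \<open>overlap\<close>.\<close>
  define v where "v a l = (if l < 4 * m \<and> l div 2 mod 2 = a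
      then c (l div 4) * (if even l then 1 else \<i>) else 0)" for a l :: nat
  have v_simps [simp]:
    "v 0 (4 * y) = c y" "v 0 (4 * y + 1) = c y * \<i>" "v 0 (4 * y + 2) = 0" "v 0 (4 * y + 3) = 0"
    "v 1 (4 * y) = 0" "v 1 (4 * y + 1) = 0" "v 1 (4 * y + 2) = c y" "v 1 (4 * y + 3) = c y * \<i>"
    if "y < m" for y
  proof -
    have *: "4 * y div 2 = 2 * y" "(4 * y + 1) div 2 = 2 * y" "(4 * y + 2) div 2 = 2 * y + 1"
      "(4 * y + 3) div 2 = 2 * y + 1" "(4 * y) div 4 = y" "(4 * y + 1) div 4 = y"
      "(4 * y + 2) div 4 = y" "(4 * y + 3) div 4 = y"
      "2 * y mod 2 = 0" "(2 * y + 1) mod 2 = 1"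
      by (simp_all add: div_mult_self1)
    have lt: "4 * y < 4 * m" "4 * y + 1 < 4 * m" "4 * y + 2 < 4 * m" "4 * y + 3 < 4 * m"
      using that by auto
    show "v 0 (4 * y) = c y" "v 0 (4 * y + 1) = c y * \<i>" "v 0 (4 * y + 2) = 0"
      "v 0 (4 * y + 3) = 0" "v 1 (4 * y) = 0" "v 1 (4 * y + 1) = 0" "v 1 (4 * y + 2) = c y"
      "v 1 (4 * y + 3) = c y * \<i>"
      unfolding v_def * using lt by simp_all
  qed
  \<comment> \<open>A general \<open>g\<close> with \<open>g l 0 = 0\<close> covers both the linear
    and the conjugate-linear pairings with \<open>v a\<close>.\<close>
  have sum_v: "(\<Sum>l<d. g l (v a l)) =
      (\<Sum>y<m. g (4 * y + 2 * a) (c y) + g (4 * y + 2 * a + 1) (c y * \<i>))"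
    if a: "a \<in> {0, 1}" and g: "\<And>l. g l 0 = 0" for a and g :: "nat \<Rightarrow> complex \<Rightarrow> complex"
  proof -
    have "(\<Sum>l<d. g l (v a l)) = (\<Sum>l<4 * m. g l (v a l))"
      using dm by (intro sum.mono_neutral_right) (auto simp: v_def g)
    also have "\<dots> = (\<Sum>y<m. g (4 * y + 2 * a) (c y) + g (4 * y + 2 * a + 1) (c y * \<i>))"
      using a v_simps g unfolding sum_lessThan_mult_4
      by (intro sum.cong refl) (auto simp: numeral_3_eq_3)
    finally show ?thesis .
  qed
  have ker: "(\<Sum>l<d. ?R $$ (j, l) * v a l) = 0" if "a \<in> {0, 1}" "j < d" for a j
  proof -
    have "(\<Sum>l<d. ?R $$ (j, l) * v a l) = (\<Sum>l<d. \<Sum>b\<in>S. b $ j * (\<alpha> l b * v a l))"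
      using that by (intro sum.cong refl) (simp add: \<alpha> sum_distrib_right sum_distrib_left mult_ac)
    also have "\<dots> = (\<Sum>b\<in>S. b $ j * (\<Sum>l<d. \<alpha> l b * v a l))"
      by (subst sum.swap) (simp add: sum_distrib_left)
    also have "\<dots> = (\<Sum>b\<in>S. b $ j * (\<Sum>y<m. f (b, a) y * c y))"
      using that by (simp add: sum_v[where g = "\<lambda>l t. \<alpha> l _ * t"] f_def algebra_simps)
    also have "\<dots> = 0"
      using c0 that by simp
    finally show ?thesis .
  qed
  have row: "(\<Sum>y<m. cnj (c y) * (\<psi> i (4 * y + 2 * a) - \<i> * \<psi> i (4 * y + 2 * a + 1))) = 0"
    if "a \<in> {0, 1}" "i < d" for a i
    using reduced_B_kernel[of d \<psi> "v a" i] ker[OF that(1)] that(2)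
      sum_v[OF that(1), of "\<lambda>l t. cnj t * \<psi> i l"]
    by (simp add: algebra_simps)
  \<comment> \<open>At an index with \<open>c x \<noteq> 0\<close>, the rows for
    \<open>a = 0\<close> and \<open>a = 1\<close> add up to row \<open>x\<close> of the contracted
    block, where only \<open>cnj (c x) * z\<close> survives.\<close>
  obtain x where x: "x < m" "c x \<noteq> 0"
    using c by blast
  have "0 = (\<Sum>y<m. cnj (c y) * (\<psi> (2 * x) (4 * y + 2 * 0) - \<i> * \<psi> (2 * x) (4 * y + 2 * 0 + 1)))
      + (\<Sum>y<m. cnj (c y) * (\<psi> (2 * x + 1) (4 * y + 2 * 1) - \<i> * \<psi> (2 * x + 1) (4 * y + 2 * 1 + 1)))"
    using row[of 0 "2 * x"] row[of 1 "2 * x + 1"] x dm by simp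
  also have "\<dots> = (\<Sum>y<m. cnj (c y) * overlap \<psi> x y)"
    by (simp add: overlap_def sum.distrib[symmetric] algebra_simps numeral_3_eq_3)
  also have "\<dots> = (\<Sum>y<m. if y = x then cnj (c x) * z else 0)"
    using x ov by (intro sum.cong) auto
  also have "\<dots> = cnj (c x) * z"
    using x by simp
  finally show False
    using x z by simp
qed

section \<open>The cone of unnormalized mixtures of pure states\<close>

text \<open>Without the trace condition, mixtures are closed under sums and nonnegative multiples.
  Membership yields positivity and a finite decomposition; normalization is postponed to
  \<open>conic_normalized\<close>.\<close>

inductive conic :: "nat \<Rightarrow> biop \<Rightarrow> bool" for d where
  zero: "conic d (\<lambda>i j k l. 0)"
| step: "conic d \<rho> \<Longrightarrow> c \<ge> 0 \<Longrightarrow> unit_bivec d v \<Longrightarrow>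
    conic d (\<lambda>i j k l. \<rho> i j k l + complex_of_real c * proj v i j k l)"

lemma conic_add:
  assumes "conic d \<tau>" "conic d \<rho>"
  shows "conic d (\<lambda>i j k l. \<rho> i j k l + \<tau> i j k l)"
  using assms
proof (induction rule: conic.induct)
  case (step \<tau> c v)
  from conic.step[OF step.IH[OF step.prems] step.hyps(2,3)] show ?case
    by (simp add: add.assoc)
qed simp

lemma conic_scale:
  assumes "conic d \<rho>" "t \<ge> 0"
  shows "conic d (\<lambda>i j k l. complex_of_real t * \<rho> i j k l)"
  using assms
proof (induction rule: conic.induct)
  case zero
  then show ?case by (simp add: conic.zero)
next
  case (step \<rho> c v)
  from conic.step[OF step.IH[OF step.prems], of "t * c"] step show ?case
    by (simp add: algebra_simps)
qed

lemma conic_sum: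
  assumes "finite T" "\<And>t. t \<in> T \<Longrightarrow> conic d (f t)"
  shows "conic d (\<lambda>i j k l. \<Sum>t\<in>T. f t i j k l)"
  using assms
proof (induction rule: finite_induct)
  case empty
  then show ?case by (simp add: conic.zero)
next
  case (insert x F)
  then show ?case
    using conic_add[of d "\<lambda>i j k l. \<Sum>t\<in>F. f t i j k l" "f x"] by simp
qed

lemma conic_proj:
  assumes v: "is_bivec d v"
  shows "conic d (proj v)"
proof -
  define N where "N = (\<Sum>i<d. \<Sum>j<d. (cmod (v i j))\<^sup>2)"
  have N: "N \<ge> 0"
    by (simp add: N_def sum_nonneg)
  show ?thesis
  proof (cases "N = 0")
    case True
    then have "(cmod (v i j))\<^sup>2 = 0" if "i < d" "j < d" for i j
      using that unfolding N_def
      by (subst (asm) sum_nonneg_eq_0_iff; (simp add: sum_nonneg)?)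
         (subst (asm) sum_nonneg_eq_0_iff; simp)
    then have "v i j = 0" for i j
      using v unfolding is_bivec_def by (metis norm_eq_zero not_le power2_eq_iff_nonneg zero_eq_power2)
    then have "proj v = (\<lambda>i j k l. 0)"
      by (simp add: proj_def)
    then show ?thesis by (simp add: conic.zero)
  next
    case False
    define u where "u i j = v i j / complex_of_real (sqrt N)" for i j
    have "unit_bivec d u"
      using v N False
      by (simp add: unit_bivec_def is_bivec_def u_def norm_divide power_divide
          sum_divide_distrib[symmetric] N_def[symmetric])
    from conic.step[OF conic.zero N this]
    have "conic d (\<lambda>i j k l. complex_of_real N * proj u i j k l)"
      by simp
    moreover have "complex_of_real N = complex_of_real (sqrt N) * complex_of_real (sqrt N)"
      using N by (metis of_real_mult real_sqrt_mult_self abs_of_nonneg)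
    then have "(\<lambda>i j k l. complex_of_real N * proj u i j k l) = proj v"
      using False N by (simp add: proj_def u_def fun_eq_iff)
    ultimately show ?thesis by simp
  qed
qed

lemma conic_decomposition:
  assumes "conic d \<rho>"
  shows "\<exists>(n::nat) (p::nat \<Rightarrow> real) (\<psi>::nat \<Rightarrow> bivec).
      (\<forall>i<n. p i \<ge> 0 \<and> unit_bivec d (\<psi> i))
      \<and> \<rho> = (\<lambda>a b c e. \<Sum>i<n. complex_of_real (p i) * proj (\<psi> i) a b c e)"
  using assms
proof (induction rule: conic.induct)
  case zero
  show ?case
    by (rule exI[of _ 0]) simp
next
  case (step \<rho> c v)
  then obtain n :: nat and p :: "nat \<Rightarrow> real" and \<psi> :: "nat \<Rightarrow> bivec" where *: "\<forall>i<n. p i \<ge> 0 \<and> unit_bivec d (\<psi> i)"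
    "\<rho> = (\<lambda>a b c e. \<Sum>i<n. complex_of_real (p i) * proj (\<psi> i) a b c e)"
    by blast
  show ?case
    by (rule exI[of _ "Suc n"], rule exI[of _ "p(n := c)"], rule exI[of _ "\<psi>(n := v)"])
       (use * step.hyps in \<open>auto simp: less_Suc_eq\<close>)
qed

lemma is_biop_conic: "conic d \<rho> \<Longrightarrow> is_biop d \<rho>"
  by (induction rule: conic.induct)
     (auto simp: is_biop_def proj_def unit_bivec_def is_bivec_def)

lemma expect_proj:
  "expect d (proj v) x = of_real ((cmod (\<Sum>i<d. \<Sum>j<d. cnj (x i j) * v i j))\<^sup>2)"
proof -
  let ?s = "\<Sum>i<d. \<Sum>j<d. cnj (x i j) * v i j"
  have "expect d (proj v) x
      = (\<Sum>i<d. \<Sum>j<d. \<Sum>k<d. \<Sum>l<d. (cnj (x i j) * v i j) * (cnj (v k l) * x k l))"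
    by (simp add: expect_def proj_def mult_ac)
  also have "\<dots> = ?s * (\<Sum>k<d. \<Sum>l<d. cnj (v k l) * x k l)"
    by (simp only: sum_distrib_left[symmetric] sum_distrib_right[symmetric])
  also have "(\<Sum>k<d. \<Sum>l<d. cnj (v k l) * x k l) = cnj ?s"
    by (simp add: mult_ac)
  finally show ?thesis
    by (simp only: complex_norm_square)
qed

lemma expect_conic:
  assumes "conic d \<rho>"
  shows "Im (expect d \<rho> x) = 0 \<and> Re (expect d \<rho> x) \<ge> 0"
  using assms
proof (induction rule: conic.induct)
  case zero
  then show ?case by (simp add: expect_def)
next
  case (step \<rho> c v)
  have "expect d (\<lambda>i j k l. \<rho> i j k l + complex_of_real c * proj v i j k l) x
      = expect d \<rho> x + complex_of_real c * expect d (proj v) x"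
    by (simp add: expect_def distrib_left distrib_right sum.distrib sum_distrib_left mult_ac)
  then show ?case
    using step by (simp add: expect_proj)
qed

lemma trace_op_mixture:
  assumes "\<forall>i<n. unit_bivec d (\<psi> i)"
  shows "trace_op d (\<lambda>a b c e. \<Sum>i<n. complex_of_real (p i) * proj (\<psi> i) a b c e)
    = complex_of_real (\<Sum>i<n. p i)"
proof -
  let ?g = "\<lambda>i a b. complex_of_real (p i) * proj (\<psi> i) a b a b"
  have "trace_op d (\<lambda>a b c e. \<Sum>i<n. complex_of_real (p i) * proj (\<psi> i) a b c e)
      = (\<Sum>a<d. \<Sum>b<d. \<Sum>i<n. ?g i a b)"
    by (simp add: trace_op_def)
  also have "\<dots> = (\<Sum>a<d. \<Sum>i<n. \<Sum>b<d. ?g i a b)"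
    by (intro sum.cong refl sum.swap)
  also have "\<dots> = (\<Sum>i<n. \<Sum>a<d. \<Sum>b<d. ?g i a b)"
    by (rule sum.swap)
  also have "\<dots> = (\<Sum>i<n. complex_of_real (p i) * (\<Sum>a<d. \<Sum>b<d. proj (\<psi> i) a b a b))"
    by (simp add: sum_distrib_left)
  also have "\<dots> = (\<Sum>i<n. complex_of_real (p i))"
  proof (intro sum.cong refl)
    fix i assume "i \<in> {..<n}"
    then have "(\<Sum>a<d. \<Sum>b<d. (cmod (\<psi> i a b))\<^sup>2) = 1"
      using assms by (simp add: unit_bivec_def)
    moreover have "(\<Sum>a<d. \<Sum>b<d. proj (\<psi> i) a b a b)
        = complex_of_real (\<Sum>a<d. \<Sum>b<d. (cmod (\<psi> i a b))\<^sup>2)"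
      by (simp add: proj_def complex_norm_square del: of_real_power)
    ultimately show "complex_of_real (p i) * (\<Sum>a<d. \<Sum>b<d. proj (\<psi> i) a b a b)
        = complex_of_real (p i)"
      by simp
  qed
  finally show ?thesis by simp
qed

lemma trace_op_scale: "trace_op d (\<lambda>i j k l. t * \<rho> i j k l) = t * trace_op d \<rho>"
  by (simp add: trace_op_def sum_distrib_left)

text \<open>The trace is the total weight of a decomposition. Total weight 0 would make every
  weight, and with it every entry, vanish.\<close>

lemma conic_trace_pos:
  assumes "conic d \<rho>" "\<rho> i j k l \<noteq> 0"
  obtains t where "t > 0" "trace_op d \<rho> = complex_of_real t"
proof -
  obtain n :: nat and p :: "nat \<Rightarrow> real" and \<psi> :: "nat \<Rightarrow> bivec" where *: "\<forall>i<n. p i \<ge> 0 \<and> unit_bivec d (\<psi> i)"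
    "\<rho> = (\<lambda>a b c e. \<Sum>i<n. complex_of_real (p i) * proj (\<psi> i) a b c e)"
    using conic_decomposition[OF assms(1)] by blast
  have "(\<Sum>i<n. p i) \<noteq> 0"
  proof
    assume "(\<Sum>i<n. p i) = 0"
    then have "\<forall>i\<in>{..<n}. p i = 0"
      using * by (subst (asm) sum_nonneg_eq_0_iff) auto
    then have "\<rho> i j k l = 0"
      using *(2) by simp
    then show False using assms(2) by simp
  qed
  moreover have "(\<Sum>i<n. p i) \<ge> 0"
    using * by (intro sum_nonneg) auto
  ultimately show thesis
    using that[of "\<Sum>i<n. p i"] trace_op_mixture[of n d \<psi> p] * by simp
qed

lemma conic_normalized:
  assumes "conic d \<rho>" "\<rho> i j k l \<noteq> 0"
  obtains t where "t > 0" "quantum_state d (\<lambda>i j k l. complex_of_real t * \<rho> i j k l)"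
    "conic d (\<lambda>i j k l. complex_of_real t * \<rho> i j k l)"
proof -
  obtain t where t: "t > 0" "trace_op d \<rho> = complex_of_real t"
    using conic_trace_pos[OF assms] .
  have c: "conic d (\<lambda>i j k l. complex_of_real (1 / t) * \<rho> i j k l)"
    using t by (intro conic_scale[OF assms(1)]) simp
  have "trace_op d (\<lambda>i j k l. complex_of_real (1 / t) * \<rho> i j k l) = 1"
    unfolding trace_op_scale using t by simp
  then have "quantum_state d (\<lambda>i j k l. complex_of_real (1 / t) * \<rho> i j k l)"
    using is_biop_conic[OF c] expect_conic[OF c] by (simp add: quantum_state_def)
  then show thesis
    using that[of "1 / t"] t c by simp
qed

lemma schmidt_rank_le: "schmidt_rank d \<psi> \<le> d"
  unfolding schmidt_rank_def by (rule vec_space.rank_le_nc) (simp add: reduced_B_def)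

text \<open>The \<open>LEAST\<close> is a genuine minimum because \<open>k = d\<close> is feasible:
  Schmidt ranks are at most \<open>d\<close>, and trace one forces the weights to sum to 1.\<close>

lemma schmidt_number_attained:
  assumes "quantum_state d \<rho>" "conic d \<rho>"
  obtains n :: nat and p :: "nat \<Rightarrow> real" and \<psi> :: "nat \<Rightarrow> bivec" where "\<forall>i<n. p i \<ge> 0 \<and> unit_bivec d (\<psi> i)"
    "\<rho> = (\<lambda>a b c e. \<Sum>i<n. complex_of_real (p i) * proj (\<psi> i) a b c e)"
    "\<forall>i<n. schmidt_rank d (\<psi> i) \<le> schmidt_number d \<rho>"
proof -
  define Q where "Q k \<longleftrightarrow> (\<exists>(n::nat) (p::nat \<Rightarrow> real) (\<psi>::nat \<Rightarrow> bivec).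
      (\<forall>i<n. p i \<ge> 0 \<and> unit_bivec d (\<psi> i)) \<and> (\<Sum>i<n. p i) = 1
      \<and> \<rho> = (\<lambda>a b c e. \<Sum>i<n. complex_of_real (p i) * proj (\<psi> i) a b c e)
      \<and> (\<forall>i<n. schmidt_rank d (\<psi> i) \<le> k))" for k
  obtain n :: nat and p :: "nat \<Rightarrow> real" and \<psi> :: "nat \<Rightarrow> bivec" where *: "\<forall>i<n. p i \<ge> 0 \<and> unit_bivec d (\<psi> i)"
    "\<rho> = (\<lambda>a b c e. \<Sum>i<n. complex_of_real (p i) * proj (\<psi> i) a b c e)"
    using conic_decomposition[OF assms(2)] by blast
  have "complex_of_real (\<Sum>i<n. p i) = 1"
    using trace_op_mixture[of n d \<psi> p] * assms(1) by (simp add: quantum_state_def)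
  then have "(\<Sum>i<n. p i) = 1"
    using of_real_eq_1_iff by blast
  then have "Q d"
    unfolding Q_def using * schmidt_rank_le by blast
  then have "Q (LEAST k. Q k)"
    by (rule LeastI)
  moreover have "schmidt_number d \<rho> = (LEAST k. Q k)"
    unfolding schmidt_number_def Q_def ..
  ultimately have "Q (schmidt_number d \<rho>)" by simp
  then show thesis
    unfolding Q_def using that by blast
qed

section \<open>Positive kernels built from involutions\<close>

text \<open>The second tensor factor carries an extra qubit, stored in the lowest bit of its index;
  \<open>e\<close> is an arbitrary state of this qubit.\<close>

definition gram :: "nat \<Rightarrow> (nat \<Rightarrow> nat \<Rightarrow> nat \<Rightarrow> nat \<Rightarrow> real) \<Rightarrow> bool" where
  "gram N \<sigma> \<longleftrightarrow> (\<forall>d e. 2 * N \<le> d \<longrightarrow>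
     conic d (\<lambda>i j k l. complex_of_real (\<sigma> i (j div 2) k (l div 2)) * (e j * cnj (e l))))"

lemma gram_add:
  assumes "gram N \<sigma>" "gram N \<tau>"
  shows "gram N (\<lambda>i j k l. \<sigma> i j k l + \<tau> i j k l)"
  unfolding gram_def
proof (intro allI impI)
  fix d and e :: "nat \<Rightarrow> complex"
  assume "2 * N \<le> d"
  then show "conic d (\<lambda>i j k l. complex_of_real (\<sigma> i (j div 2) k (l div 2) + \<tau> i (j div 2) k (l div 2))
      * (e j * cnj (e l)))"
    unfolding of_real_add distrib_right
    using assms by (intro conic_add) (auto simp: gram_def)
qed

lemma gram_family:
  assumes "finite T" and w: "\<And>t. t \<in> T \<Longrightarrow> w t \<ge> 0"
    and v: "\<And>t i j. t \<in> T \<Longrightarrow> N \<le> i \<or> N \<le> j \<Longrightarrow> v t i j = 0"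
  shows "gram N (\<lambda>i j k l. \<Sum>t\<in>T. w t * (v t i j * v t k l))"
  unfolding gram_def
proof (intro allI impI)
  fix d and e :: "nat \<Rightarrow> complex"
  assume d: "2 * N \<le> d"
  define u where "u t i j = complex_of_real (v t i (j div 2)) * e j" for t i j
  have "is_bivec d (u t)" if "t \<in> T" for t
    unfolding is_bivec_def
  proof (intro allI impI)
    fix i j assume "d \<le> i \<or> d \<le> j"
    then have "N \<le> i \<or> N \<le> j div 2"
      using d by auto
    then show "u t i j = 0"
      using v[OF that] by (simp add: u_def)
  qed
  then have "conic d (\<lambda>i j k l. \<Sum>t\<in>T. complex_of_real (w t) * proj (u t) i j k l)"
    using assms(1) w by (intro conic_sum conic_scale conic_proj)
  then show "conic d (\<lambda>i j k l. complex_of_real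
      (\<Sum>t\<in>T. w t * (v t i (j div 2) * v t k (l div 2))) * (e j * cnj (e l)))"
    by (simp add: proj_def u_def sum_distrib_left sum_distrib_right mult_ac)
qed

text \<open>With \<open>\<Phi>\<close> the permutation operator of \<open>\<phi>\<close>, the
  vectors are \<open>(1 + \<epsilon> \<Phi>) |t>\<close>. As \<open>g\<close> commutes with
  \<open>\<Phi>\<close>, the sum is
  \<open>g (1 + \<epsilon> \<Phi>)^2 = 2 g (1 + \<epsilon> \<Phi>)\<close>.\<close>

lemma sum_involution_pairs:
  fixes g :: "'a \<Rightarrow> real"
  assumes T: "finite T" and \<phi>: "\<And>t. t \<in> T \<Longrightarrow> \<phi> t \<in> T" "\<And>t. t \<in> T \<Longrightarrow> \<phi> (\<phi> t) = t"
    and g: "\<And>t. t \<in> T \<Longrightarrow> g (\<phi> t) = g t" and \<epsilon>: "\<epsilon> * \<epsilon> = 1"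
  shows "(\<Sum>t\<in>T. g t * ((of_bool (u = t) + \<epsilon> * of_bool (u = \<phi> t)) *
      (of_bool (u' = t) + \<epsilon> * of_bool (u' = \<phi> t)))) =
    (if u \<in> T \<and> u' \<in> T then 2 * g u * (of_bool (u = u') + \<epsilon> * of_bool (u' = \<phi> u)) else 0)"
proof (cases "u \<in> T \<and> u' \<in> T")
  case False
  then have "(of_bool (u = t) + \<epsilon> * of_bool (u = \<phi> t)) *
      (of_bool (u' = t) + \<epsilon> * of_bool (u' = \<phi> t)) = 0" if "t \<in> T" for t
    using that \<phi>(1) by (auto simp: of_bool_def)
  then have "(\<Sum>t\<in>T. g t * ((of_bool (u = t) + \<epsilon> * of_bool (u = \<phi> t)) *
      (of_bool (u' = t) + \<epsilon> * of_bool (u' = \<phi> t)))) = 0"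
    by (metis (no_types, lifting) mult_zero_right sum.neutral)
  then show ?thesis
    unfolding if_not_P[OF False] .
next
  case True
  define h where "h t = g t * (of_bool (u' = t) + \<epsilon> * of_bool (u' = \<phi> t))" for t
  have flip: "u = \<phi> t \<longleftrightarrow> t = \<phi> u" if "t \<in> T" for t
    using that \<phi>(2) True by metis
  have "(\<Sum>t\<in>T. g t * ((of_bool (u = t) + \<epsilon> * of_bool (u = \<phi> t)) *
      (of_bool (u' = t) + \<epsilon> * of_bool (u' = \<phi> t))))
    = (\<Sum>t\<in>T. (if t = u then h t else 0) + (if t = \<phi> u then \<epsilon> * h t else 0))"
    using flip by (intro sum.cong refl) (auto simp: h_def of_bool_def algebra_simps)
  also have "\<dots> = h u + \<epsilon> * h (\<phi> u)"
    using T True \<phi>(1) by (simp add: sum.distrib)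
  also have "\<dots> = g u * (of_bool (u' = u) + \<epsilon> * of_bool (u' = \<phi> u))
      + g u * (\<epsilon> * of_bool (u' = \<phi> u) + (\<epsilon> * \<epsilon>) * of_bool (u' = u))"
    using True \<phi> g by (simp add: h_def algebra_simps)
  also have "\<dots> = 2 * g u * (of_bool (u = u') + \<epsilon> * of_bool (u' = \<phi> u))"
    unfolding \<epsilon> by (simp add: algebra_simps eq_commute)
  finally show ?thesis
    using True by simp
qed

lemma gram_involution:
  assumes \<phi>: "\<And>i j. i < N \<Longrightarrow> j < N \<Longrightarrow> \<phi> (i, j) \<in> {..<N} \<times> {..<N}"
      "\<And>i j. i < N \<Longrightarrow> j < N \<Longrightarrow> \<phi> (\<phi> (i, j)) = (i, j)"
    and g: "\<And>i j. i < N \<Longrightarrow> j < N \<Longrightarrow> g (\<phi> (i, j)) = g (i, j)"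
      "\<And>i j. i < N \<Longrightarrow> j < N \<Longrightarrow> g (i, j) \<ge> 0" and \<epsilon>: "\<epsilon> * \<epsilon> = 1"
  shows "gram N (\<lambda>i j k l. if i < N \<and> j < N \<and> k < N \<and> l < N
    then g (i, j) * (of_bool (i = k \<and> j = l) + \<epsilon> * of_bool ((k, l) = \<phi> (i, j))) else 0)"
proof -
  let ?T = "{..<N} \<times> {..<N}"
  let ?v = "\<lambda>t i j. of_bool ((i, j) = t) + \<epsilon> * of_bool ((i, j) = \<phi> t)"
  \<comment> \<open>The weight \<open>g t / 2\<close> cancels the factor 2 of
    \<open>sum_involution_pairs\<close>.\<close>
  have "gram N (\<lambda>i j k l. \<Sum>t\<in>?T. g t / 2 * (?v t i j * ?v t k l))"
  proof (rule gram_family)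
    fix t i j assume t: "t \<in> ?T" "N \<le> i \<or> N \<le> j"
    then have "(i, j) \<noteq> t" "\<phi> t \<in> ?T" "(i, j) \<notin> ?T"
      using \<phi>(1) by auto
    then have "(i, j) \<noteq> t" "(i, j) \<noteq> \<phi> t"
      by metis+
    then show "?v t i j = 0" by simp
  qed (use g in auto)
  also have "(\<lambda>i j k l. \<Sum>t\<in>?T. g t / 2 * (?v t i j * ?v t k l)) =
     (\<lambda>i j k l. if i < N \<and> j < N \<and> k < N \<and> l < N
    then g (i, j) * (of_bool (i = k \<and> j = l) + \<epsilon> * of_bool ((k, l) = \<phi> (i, j))) else 0)"
  proof (intro ext)
    fix i j k l :: nat
    show "(\<Sum>t\<in>?T. g t / 2 * (?v t i j * ?v t k l)) =
      (if i < N \<and> j < N \<and> k < N \<and> l < N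
        then g (i, j) * (of_bool (i = k \<and> j = l) + \<epsilon> * of_bool ((k, l) = \<phi> (i, j))) else 0)"
      using \<phi> g by (subst sum_involution_pairs[where g = "\<lambda>t. g t / 2"]) (auto simp: \<epsilon>)
  qed
  finally show ?thesis .
qed

section \<open>The Bell-diagonal kernel and its partial transpose\<close>

text \<open>An index below \<open>2 * m\<close> encodes a basis vector of \<open>C^2 (x) C^m\<close>, the qubit being the lowest
  bit. With \<open>P\<close> the projection onto the diagonal qubit pairs \<open>00\<close>, \<open>11\<close>, \<open>R\<close> the simultaneous flip of
  both qubits and \<open>\<Omega>\<close> the unnormalized maximally entangled vector, the kernel below is that of
  \<open>\<Omega>\<Omega>* + (1 - R) P + 2 (1 - P)\<close>. Its partial transpose is \<open>(1 + F) + (1 - R) (1 - P)\<close> with \<open>F\<close> the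
  swap of the two factors, because partial transposition moves \<open>R P\<close> to \<open>R (1 - P)\<close>.\<close>

definition bit_flip :: "nat \<Rightarrow> nat" where
  "bit_flip n = (if even n then n + 1 else n - 1)"

lemma bit_flip_flip [simp]: "bit_flip (bit_flip n) = n"
  by (auto simp: bit_flip_def)

lemma even_bit_flip [simp]: "even (bit_flip n) \<longleftrightarrow> odd n"
  by (auto simp: bit_flip_def)

lemma bit_flip_less: "even N \<Longrightarrow> n < N \<Longrightarrow> bit_flip n < N"
  by (auto simp: bit_flip_def) presburger

lemma bit_flip_simps [simp]:
  "bit_flip (2 * x) = 2 * x + 1" "bit_flip (Suc (2 * x)) = 2 * x"
  by (auto simp: bit_flip_def)

lemma eq_bit_flip_commute: "i = bit_flip j \<longleftrightarrow> j = bit_flip i"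
  by auto

definition ppt_kernel :: "nat \<Rightarrow> nat \<Rightarrow> nat \<Rightarrow> nat \<Rightarrow> nat \<Rightarrow> real" where
  "ppt_kernel N i j k l = (if i < N \<and> j < N \<and> k < N \<and> l < N then
     of_bool (i = j \<and> k = l) + of_bool (i = k \<and> j = l) * (1 + of_bool (odd (i + j)))
     - of_bool (even (i + j) \<and> k = bit_flip i \<and> l = bit_flip j) else 0)"

lemma gram_ppt_kernel:
  assumes "even N"
  shows "gram N (ppt_kernel N)"
proof -
  let ?K1 = "(\<lambda>i j k l. \<Sum>t\<in>{()}. 1 *
      (of_bool (i = j \<and> i < N) * of_bool (k = l \<and> k < N)))
    :: nat \<Rightarrow> nat \<Rightarrow> nat \<Rightarrow> nat \<Rightarrow> real"
  let ?K2 = "(\<lambda>i j k l. if i < N \<and> j < N \<and> k < N \<and> l < N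
    then (\<lambda>(i, j). of_bool (even (i + j))) (i, j) * (of_bool (i = k \<and> j = l)
      + (- 1) * of_bool ((k, l) = (\<lambda>(i, j). (bit_flip i, bit_flip j)) (i, j))) else 0)
    :: nat \<Rightarrow> nat \<Rightarrow> nat \<Rightarrow> nat \<Rightarrow> real"
  \<comment> \<open>Taking the identity as the involution with sign \<open>+1\<close> doubles the
    diagonal, which gives the term \<open>2 (1 - P)\<close>.\<close>
  let ?K3 = "(\<lambda>i j k l. if i < N \<and> j < N \<and> k < N \<and> l < N
    then (\<lambda>(i, j). of_bool (odd (i + j))) (i, j) * (of_bool (i = k \<and> j = l)
      + 1 * of_bool ((k, l) = id (i, j))) else 0)
    :: nat \<Rightarrow> nat \<Rightarrow> nat \<Rightarrow> nat \<Rightarrow> real"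
  have 1: "gram N ?K1"
    by (rule gram_family) auto
  have 2: "gram N ?K2"
    using assms by (intro gram_involution) (auto simp: bit_flip_less)
  have 3: "gram N ?K3"
    by (intro gram_involution) auto
  have "ppt_kernel N = (\<lambda>i j k l. ?K1 i j k l + ?K2 i j k l + ?K3 i j k l)"
  proof (intro ext)
    fix i j k l :: nat
    show "ppt_kernel N i j k l = ?K1 i j k l + ?K2 i j k l + ?K3 i j k l"
    proof (cases "i < N \<and> j < N \<and> k < N \<and> l < N")
      case True
      then show ?thesis
        by (cases "even i"; cases "even j") (simp_all add: ppt_kernel_def of_bool_conj)
    next
      case False
      then show ?thesis
        unfolding ppt_kernel_def if_not_P[OF False] by auto
    qed
  qed
  then show ?thesis
    using gram_add[OF gram_add[OF 1 2] 3] by simp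
qed

lemma gram_ppt_kernel_transpose:
  assumes "even N"
  shows "gram N (\<lambda>i j k l. ppt_kernel N i l k j)"
proof -
  let ?K1 = "(\<lambda>i j k l. if i < N \<and> j < N \<and> k < N \<and> l < N
    then (\<lambda>_. 1) (i, j) * (of_bool (i = k \<and> j = l)
      + 1 * of_bool ((k, l) = prod.swap (i, j))) else 0)
    :: nat \<Rightarrow> nat \<Rightarrow> nat \<Rightarrow> nat \<Rightarrow> real"
  let ?K2 = "(\<lambda>i j k l. if i < N \<and> j < N \<and> k < N \<and> l < N
    then (\<lambda>(i, j). of_bool (odd (i + j))) (i, j) * (of_bool (i = k \<and> j = l)
      + (- 1) * of_bool ((k, l) = (\<lambda>(i, j). (bit_flip i, bit_flip j)) (i, j))) else 0)
    :: nat \<Rightarrow> nat \<Rightarrow> nat \<Rightarrow> nat \<Rightarrow> real"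
  have 1: "gram N ?K1"
    by (intro gram_involution) auto
  have 2: "gram N ?K2"
    using assms by (intro gram_involution) (auto simp: bit_flip_less)
  have "(\<lambda>i j k l. ppt_kernel N i l k j) = (\<lambda>i j k l. ?K1 i j k l + ?K2 i j k l)"
  proof (intro ext)
    fix i j k l :: nat
    have diag: "of_bool (i = k \<and> l = j) * (1 + of_bool (odd (i + l))) =
        (of_bool (i = k \<and> j = l) * (1 + of_bool (odd (i + j))) :: real)"
      by (cases "j = l") simp_all
    \<comment> \<open>\<open>bit_flip\<close> changes parity, so exchanging \<open>j\<close> with
      \<open>l = bit_flip j\<close> turns the condition of even sum into one of odd sum.\<close>
    have flip: "even (i + l) \<and> k = bit_flip i \<and> j = bit_flip l \<longleftrightarrow>
        odd (i + j) \<and> k = bit_flip i \<and> l = bit_flip j"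
      unfolding eq_bit_flip_commute[of j l] by (cases "l = bit_flip j") simp_all
    have swap: "i = l \<and> k = j \<longleftrightarrow> k = j \<and> l = i"
      by blast
    show "ppt_kernel N i l k j = ?K1 i j k l + ?K2 i j k l"
    proof (cases "i < N \<and> j < N \<and> k < N \<and> l < N")
      case True
      then show ?thesis
        unfolding ppt_kernel_def diag flip swap
        by (cases "even i"; cases "even j") (simp_all add: of_bool_conj)
    next
      case False
      then show ?thesis
        unfolding ppt_kernel_def if_not_P[OF False] by auto
    qed
  qed
  then show ?thesis
    using gram_add[OF 1 2] by simp
qed

definition phase :: "nat \<Rightarrow> complex" where
  "phase n = (if even n then 1 else \<i>)"

text \<open>The qubit states \<open>(1, \<i>)\<close> and \<open>(1, -\<i>)\<close> are orthogonal, and transposition exchanges their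
  projections. Attaching them as flags to an operator and to its partial transpose gives an
  invariant operator from which either part can be recovered locally.\<close>

definition inv_kernel :: "nat \<Rightarrow> biop" where
  "inv_kernel N = (\<lambda>i j k l.
     complex_of_real (ppt_kernel N i (j div 2) k (l div 2)) * (phase j * cnj (phase l))
     + complex_of_real (ppt_kernel N i (l div 2) k (j div 2)) * (cnj (phase j) * phase l))"

text \<open>Exchanging \<open>j\<close> and \<open>l\<close> swaps the two summands.\<close>

lemma partial_transpose_inv_kernel: "partial_transpose_B (inv_kernel N) = inv_kernel N"
  by (simp add: partial_transpose_B_def inv_kernel_def fun_eq_iff mult_ac add_ac)

lemma conic_inv_kernel:
  assumes "even N" "2 * N \<le> d"
  shows "conic d (inv_kernel N)"
proof -
  have "conic d (\<lambda>i j k l. complex_of_real (ppt_kernel N i (j div 2) k (l div 2))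
      * (phase j * cnj (phase l)))"
    using gram_ppt_kernel[OF assms(1)] assms(2) unfolding gram_def by blast
  moreover have "conic d (\<lambda>i j k l. complex_of_real (ppt_kernel N i (l div 2) k (j div 2))
      * (cnj (phase j) * cnj (cnj (phase l))))"
    using gram_ppt_kernel_transpose[OF assms(1)] assms(2) unfolding gram_def
    by (elim allE[of _ d] allE[of _ "\<lambda>j. cnj (phase j)"]) simp
  ultimately show ?thesis
    unfolding inv_kernel_def complex_cnj_cnj by (rule conic_add[rotated])
qed

section \<open>Contraction of mixtures to a maximally entangled state\<close>

text \<open>The kernel of \<open>C \<rho> C^*\<close> for the linear map \<open>C\<close> given by
  \<open>overlap\<close>; the conjugations let \<open>C\<close> act on the bra indices.\<close>

definition overlap_op :: "biop \<Rightarrow> nat \<Rightarrow> nat \<Rightarrow> nat \<Rightarrow> nat \<Rightarrow> complex" where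
  "overlap_op \<rho> x y x' y' =
     overlap (\<lambda>i j. cnj (overlap (\<lambda>k l. cnj (\<rho> i j k l)) x' y')) x y"

lemma overlap_sum: "overlap (\<lambda>i j. \<Sum>t<n. f t i j) x y = (\<Sum>t<n. overlap (f t) x y)"
  by (simp add: overlap_def sum.distrib sum_subtractf sum_distrib_left)

lemma overlap_mult: "overlap (\<lambda>i j. c * \<psi> i j) x y = c * overlap \<psi> x y"
  by (simp add: overlap_def distrib_left right_diff_distrib mult.left_commute)

lemma overlap_op_mixture:
  "overlap_op (\<lambda>a b c e. \<Sum>i<n. complex_of_real (p i) * proj (\<psi> i) a b c e) x y x' y'
    = (\<Sum>i<n. complex_of_real (p i) * (overlap (\<psi> i) x y * cnj (overlap (\<psi> i) x' y')))"
proof -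
  have inner: "(\<lambda>k l. cnj (\<Sum>t<n. complex_of_real (p t) * proj (\<psi> t) i j k l))
      = (\<lambda>k l. \<Sum>t<n. (complex_of_real (p t) * cnj (\<psi> t i j)) * \<psi> t k l)" for i j
    by (simp add: proj_def mult.assoc)
  have outer: "(\<lambda>i j. cnj (\<Sum>t<n. (complex_of_real (p t) * cnj (\<psi> t i j)) * overlap (\<psi> t) x' y'))
      = (\<lambda>i j. \<Sum>t<n. (complex_of_real (p t) * cnj (overlap (\<psi> t) x' y')) * \<psi> t i j)"
    by (simp add: mult_ac)
  show ?thesis
    unfolding overlap_op_def inner overlap_sum overlap_mult outer
    by (simp add: mult_ac)
qed

lemma overlap_op_scale:
  "overlap_op (\<lambda>i j k l. complex_of_real t * \<rho> i j k l) x y x' y' = t * overlap_op \<rho> x y x' y'"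
  by (simp add: overlap_op_def overlap_mult)

text \<open>The flag of the transposed summand is orthogonal to the contracted flag. In the other
  summand the flag contributes \<open>2 * 2\<close>, the four qubit entries contribute 4 from
  \<open>\<Omega>\<Omega>*\<close>, and the terms of \<open>(1 - R) P\<close> cancel since
  \<open>R\<close> fixes the Bell state.\<close>

lemma overlap_op_inv_kernel:
  assumes "x < m" "y < m" "x' < m" "y' < m"
  shows "overlap_op (inv_kernel (2 * m)) x y x' y' = 16 * of_bool (x = y \<and> x' = y')"
proof -
  have div: "4 * y div 2 = 2 * y" "(4 * y + 1) div 2 = 2 * y" "(4 * y + 2) div 2 = 2 * y + 1"
      "(4 * y + 3) div 2 = 2 * y + 1" for y :: nat
    by linarith+
  have phase: "phase (4 * y) = 1" "phase (4 * y + 1) = \<i>" "phase (4 * y + 2) = 1"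
      "phase (4 * y + 3) = \<i>" for y
    by (simp_all add: phase_def)
  have ne: "2 * a \<noteq> 2 * b + 1" "2 * b + 1 \<noteq> 2 * a" for a b :: nat
    by presburger+
  have K: "ppt_kernel (2 * m) (2 * x) (2 * y) (2 * x') (2 * y') = of_bool (x = y \<and> x' = y') + of_bool (x = x' \<and> y = y')"
    "ppt_kernel (2 * m) (2 * x + 1) (2 * y + 1) (2 * x' + 1) (2 * y' + 1) = of_bool (x = y \<and> x' = y') + of_bool (x = x' \<and> y = y')"
    "ppt_kernel (2 * m) (2 * x) (2 * y) (2 * x' + 1) (2 * y' + 1) = of_bool (x = y \<and> x' = y') - of_bool (x = x' \<and> y = y')"
    "ppt_kernel (2 * m) (2 * x + 1) (2 * y + 1) (2 * x') (2 * y') = of_bool (x = y \<and> x' = y') - of_bool (x = x' \<and> y = y')"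
    using assms ne by (auto simp: ppt_kernel_def)
  show ?thesis
    unfolding overlap_op_def overlap_def inv_kernel_def div phase K
    by (simp add: algebra_simps)
qed

text \<open>For a linear functional \<open>f\<close> of the components: if its quadratic form
  vanishes on the mixture, it vanishes on each component of positive weight.\<close>

lemma mixture_coefficient_zero:
  fixes n :: nat
  assumes "\<And>i. i < n \<Longrightarrow> p i \<ge> 0"
    and "(\<Sum>i<n. complex_of_real (p i) * (f i * cnj (f i))) = 0" "i < n" "p i > 0"
  shows "f i = 0"
proof -
  have "complex_of_real (\<Sum>i<n. p i * (cmod (f i))\<^sup>2) = 0"
    using assms(2) by (simp add: complex_norm_square del: of_real_power)
  then have "(\<Sum>i<n. p i * (cmod (f i))\<^sup>2) = 0"
    using of_real_eq_0_iff by blast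
  then have "\<forall>i\<in>{..<n}. p i * (cmod (f i))\<^sup>2 = 0"
    using assms(1) by (subst (asm) sum_nonneg_eq_0_iff) auto
  then have "p i * (cmod (f i))\<^sup>2 = 0"
    using assms(3) by blast
  then show ?thesis
    using assms(4) by simp
qed

text \<open>A rank-one operator is extremal, so every component of positive weight contracts to a
  multiple of the maximally entangled vector. The entry at index 0 singles out a component with
  nonzero multiple.\<close>

lemma schmidt_rank_of_mixture:
  fixes n :: nat
  assumes "4 * m \<le> d" "0 < m" "c \<noteq> 0" and p: "\<And>i. i < n \<Longrightarrow> p i \<ge> (0 :: real)"
    and ov: "\<And>x y x' y'. x < m \<Longrightarrow> y < m \<Longrightarrow> x' < m \<Longrightarrow> y' < m \<Longrightarrow>
      (\<Sum>i<n. complex_of_real (p i) * (overlap (\<psi> i) x y * cnj (overlap (\<psi> i) x' y')))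
      = c * of_bool (x = y \<and> x' = y')"
  obtains i where "i < n" "m \<le> 2 * schmidt_rank d (\<psi> i)"
proof -
  let ?o = "\<lambda>i. overlap (\<psi> i)"
  have "\<exists>i<n. p i > 0 \<and> ?o i 0 0 \<noteq> 0"
  proof (rule ccontr)
    assume *: "\<not> ?thesis"
    have "complex_of_real (p i) * (?o i 0 0 * cnj (?o i 0 0)) = 0" if "i < n" for i
      using * p[OF that] that by (cases "p i = 0") auto
    then have "(\<Sum>i<n. complex_of_real (p i) * (?o i 0 0 * cnj (?o i 0 0))) = 0"
      by (intro sum.neutral) blast
    then show False
      using ov[of 0 0 0 0] assms(2,3) by simp
  qed
  then obtain i where i: "i < n" "p i > 0" "?o i 0 0 \<noteq> 0"
    by blast
  have off: "?o i x y = 0" if "x < m" "y < m" "x \<noteq> y" for x y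
    using mixture_coefficient_zero[of n p "\<lambda>i. ?o i x y" i] ov[of x y x y] that p i by auto
  \<comment> \<open>The quadratic form of this difference on the mixture is
    \<open>c - c - c + c = 0\<close>.\<close>
  have diag: "?o i x x - ?o i 0 0 = 0" if "x < m" for x
  proof (rule mixture_coefficient_zero[of n p "\<lambda>i. ?o i x x - ?o i 0 0" i])
    have "(\<Sum>i<n. complex_of_real (p i) * ((?o i x x - ?o i 0 0) * cnj (?o i x x - ?o i 0 0)))
      = (\<Sum>i<n. complex_of_real (p i) * (?o i x x * cnj (?o i x x)))
      - (\<Sum>i<n. complex_of_real (p i) * (?o i x x * cnj (?o i 0 0)))
      - (\<Sum>i<n. complex_of_real (p i) * (?o i 0 0 * cnj (?o i x x)))
      + (\<Sum>i<n. complex_of_real (p i) * (?o i 0 0 * cnj (?o i 0 0)))"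
      by (simp add: sum_subtractf[symmetric] sum.distrib[symmetric] algebra_simps)
    also have "\<dots> = 0"
      unfolding ov[OF that that that that] ov[OF that that assms(2) assms(2)]
        ov[OF assms(2) assms(2) that that] ov[OF assms(2) assms(2) assms(2) assms(2)]
      by simp
    finally show "(\<Sum>i<n. complex_of_real (p i) *
        ((?o i x x - ?o i 0 0) * cnj (?o i x x - ?o i 0 0))) = 0" .
  qed (use p i in auto)
  have "m \<le> 2 * schmidt_rank d (\<psi> i)"
  proof (rule schmidt_rank_ge[OF assms(1) i(3)])
    fix x y assume "x < m" "y < m"
    then show "?o i x y = (if x = y then ?o i 0 0 else 0)"
      using diag[of x] off[of x y] by (cases "x = y") simp_all
  qed
  then show thesis
    using that i by blast
qed

theorem theorem10:
  fixes d :: nat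
  assumes "d \<ge> 4"
  shows "\<exists>\<rho>. quantum_state d \<rho> \<and> partial_transpose_B \<rho> = \<rho> \<and>
           int (schmidt_number d \<rho>) \<ge>
             (if even d then \<lceil>(real d - 2) / 8\<rceil> else \<lceil>(real d - 3) / 8\<rceil>)"
proof -
  \<comment> \<open>The second factor holds \<open>C^m\<close>, a qubit and the flag, so it needs
    \<open>4 * m \<le> d\<close>; the first needs only \<open>2 * m\<close>.\<close>
  define m where "m = d div 4"
  have m: "0 < m" "4 * m \<le> d"
    using assms by (auto simp: m_def)
  let ?K = "inv_kernel (2 * m)"
  have "?K 0 0 0 0 \<noteq> 0"
    using m by (simp add: inv_kernel_def ppt_kernel_def phase_def bit_flip_def)
  with conic_inv_kernel[of "2 * m" d] m obtain t where t: "t > 0"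
    "quantum_state d (\<lambda>i j k l. complex_of_real t * ?K i j k l)"
    "conic d (\<lambda>i j k l. complex_of_real t * ?K i j k l)"
    using conic_normalized[of d ?K 0 0 0 0] by auto
  define \<rho> where "\<rho> = (\<lambda>i j k l. complex_of_real t * ?K i j k l)"
  have state: "quantum_state d \<rho>" "conic d \<rho>"
    using t(2,3) by (simp_all add: \<rho>_def)
  obtain n :: nat and p :: "nat \<Rightarrow> real" and \<psi> :: "nat \<Rightarrow> bivec" where dec: "\<forall>i<n. p i \<ge> (0::real) \<and> unit_bivec d (\<psi> i)"
    "\<rho> = (\<lambda>a b c e. \<Sum>i<n. complex_of_real (p i) * proj (\<psi> i) a b c e)"
    "\<forall>i<n. schmidt_rank d (\<psi> i) \<le> schmidt_number d \<rho>"
    by (rule schmidt_number_attained[OF state])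
  have ov: "(\<Sum>i<n. complex_of_real (p i) * (overlap (\<psi> i) x y * cnj (overlap (\<psi> i) x' y')))
      = complex_of_real (16 * t) * of_bool (x = y \<and> x' = y')"
    if "x < m" "y < m" "x' < m" "y' < m" for x y x' y'
    unfolding overlap_op_mixture[symmetric] dec(2)[symmetric]
    unfolding \<rho>_def overlap_op_scale overlap_op_inv_kernel[OF that] by simp
  have "complex_of_real (16 * t) \<noteq> 0" and "\<And>i. i < n \<Longrightarrow> p i \<ge> 0"
    using t(1) dec(1) by simp_all
  from schmidt_rank_of_mixture[OF m(2,1) this ov]
  obtain i where "i < n" "m \<le> 2 * schmidt_rank d (\<psi> i)" .
  with dec(3) have "m \<le> 2 * schmidt_number d \<rho>"
    by (meson le_trans mult_le_mono2)
  then have "d div 4 \<le> 2 * schmidt_number d \<rho>"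
    by (simp add: m_def)
  \<comment> \<open>The bound on \<open>d div 4\<close> gives \<open>d \<le> 8 * s + 3\<close> for
    the Schmidt number \<open>s\<close>; parity saves one more for even \<open>d\<close>.\<close>
  then have "if even d then d \<le> 8 * schmidt_number d \<rho> + 2 else d \<le> 8 * schmidt_number d \<rho> + 3"
    by presburger
  then have "(if even d then \<lceil>(real d - 2) / 8\<rceil> else \<lceil>(real d - 3) / 8\<rceil>) \<le> int (schmidt_number d \<rho>)"
    by (auto simp: ceiling_le_iff split: if_splits)
  moreover have "partial_transpose_B \<rho> = \<rho>"
    using partial_transpose_inv_kernel[of "2 * m"]
    by (auto simp: \<rho>_def partial_transpose_B_def fun_eq_iff)
  ultimately show ?thesis
    using t(2) unfolding \<rho>_def by blast
qed

end
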